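(* Let $\delta_{r,m}(\xi)\in[0,1]$ be defined by $$\delta_{r,m}(\xi)=\max_{v_r\in X_r,\,v_r\neq0}\ \min_{w_r\in X_r}\frac{\|v_r-R_X^{-1}(P_m(\xi)A(\xi))^TR_Xw_r\|_X}{\|v_r\|_X}.$$ Let $u_r^*(\xi)\in X_r$ and $u_r(\xi)\in X_r$ be solutions of, respectively, $$\langle u_r^*(\xi)-u(\xi),R_Xv_r\rangle=0\quad\forall v_r\in X_r,$$ $$\langle A(\xi)u_r(\xi)-b(\xi),P_m(\xi)^TR_Xv_r\rangle=0\quad\forall v_r\in X_r.$$ Then $$\|u_r^*(\xi)-u_r(\xi)\|_X\leq\delta_{r,m}(\xi)\,\|u(\xi)-u_r(\xi)\|_X.$$ Moreover, if $\delta_{r,m}(\xi)<1$, then $$\|u(\xi)-u_r(\xi)\|_X\leq(1-\delta_{r,m}(\xi)^2)^{-1/2}\,\|u(\xi)-u_r^*(\xi)\|_X.$$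
   Context: For a parameter value $\xi$ in a parameter set $\Xi$, $A(\xi)\in\mathbb{R}^{n\times n}$ is invertible, $b(\xi)\in\mathbb{R}^n$, and $u(\xi)\in\mathbb{R}^n$ is the solution of $A(\xi)u(\xi)=b(\xi)$. $X=\mathbb{R}^n$ is endowed with the norm $\|v\|_X^2=\langle R_Xv,v\rangle$, where $R_X$ is symmetric positive definite and $\langle\cdot,\cdot\rangle$ is the canonical inner product of $\mathbb{R}^n$. $X_r\subset X$ is a subspace of dimension $r$. $P_m(\xi)\in\mathbb{R}^{n\times n}$ is a preconditioner of the form $P_m(\xi)=\sum_{i=1}^m\lambda_i(\xi)A(\xi_i)^{-1}$, with real coefficients $\lambda_i(\xi)$ and points $\xi_1,\dots,\xi_m\in\Xi$. *)

theory Defs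
  imports "HOL-Analysis.Analysis"
begin

definition spd_matrix :: "real^'n^'n \<Rightarrow> bool" where
  "spd_matrix R \<longleftrightarrow> transpose R = R \<and> (\<forall>v. v \<noteq> 0 \<longrightarrow> (R *v v) \<bullet> v > 0)"

definition norm_X :: "real^'n^'n \<Rightarrow> real^'n \<Rightarrow> real" where
  "norm_X R v = sqrt ((R *v v) \<bullet> v)"

definition preconditioner ::
  "('p \<Rightarrow> real^'n^'n) \<Rightarrow> nat \<Rightarrow> (nat \<Rightarrow> 'p \<Rightarrow> real) \<Rightarrow> (nat \<Rightarrow> 'p) \<Rightarrow> 'p \<Rightarrow> real^'n^'n" where
  "preconditioner A m lam pts \<xi> = (\<Sum>i=1..m. lam i \<xi> *\<^sub>R matrix_inv (A (pts i)))"

definition min_ratio ::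
  "real^'n^'n \<Rightarrow> (real^'n) set \<Rightarrow> real^'n^'n \<Rightarrow> real^'n \<Rightarrow> real" where
  "min_ratio R Xr B v =
     (LEAST d. \<exists>w\<in>Xr. d = norm_X R (v - matrix_inv R *v (transpose B *v (R *v w))) / norm_X R v)"

text \<open>
  The max-min constant for \<open>B = P\<^sub>m(\<xi>) A(\<xi>)\<close>. The minimum and the maximum are taken over infinite sets
  of reals, so they are written with \<open>LEAST\<close> and \<open>GREATEST\<close> (\<open>Max\<close> and \<open>Min\<close> are for finite sets only).
  For symmetric positive definite \<open>R\<close> and a nonzero subspace \<open>Xr\<close> both are attained. If \<open>Xr\<close> is the
  zero subspace, the maximum over the empty set of ratios in \<open>[0,1]\<close> is read as 0.
\<close>

definition delta :: "real^'n^'n \<Rightarrow> (real^'n) set \<Rightarrow> real^'n^'n \<Rightarrow> real" where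
  "delta R Xr B =
     (if Xr \<subseteq> {0} then 0
      else (GREATEST d. \<exists>v\<in>Xr. v \<noteq> 0 \<and> d = min_ratio R Xr B v))"

end

theory Submission
  imports Defs
begin

text \<open>
  Write \<open>\<langle>x, y\<rangle>\<^sub>X = \<langle>R x, y\<rangle>\<close>, \<open>B = P\<^sub>m(\<xi>) A(\<xi>)\<close> and \<open>B\<^sup>* = R\<^sup>-\<^sup>1 B\<^sup>T R\<close>, the adjoint of \<open>B\<close> for this
  inner product. Since \<open>A u = b\<close>, the equations that define \<open>u\<^sub>r\<close> say that the error \<open>u - u\<^sub>r\<close> is
  \<open>X\<close>-orthogonal to \<open>B\<^sup>* X\<^sub>r\<close>, and those that define \<open>u\<^sub>r\<^sup>*\<close> say that \<open>u - u\<^sub>r\<^sup>*\<close> is \<open>X\<close>-orthogonal to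
  \<open>X\<^sub>r\<close>. Put \<open>e = u\<^sub>r\<^sup>* - u\<^sub>r \<in> X\<^sub>r\<close>. For every \<open>w \<in> X\<^sub>r\<close>,
  \<open>\<parallel>e\<parallel>\<^sup>2 = \<langle>u - u\<^sub>r, e\<rangle>\<^sub>X = \<langle>u - u\<^sub>r, e - B\<^sup>* w\<rangle>\<^sub>X \<le> \<parallel>u - u\<^sub>r\<parallel> \<parallel>e - B\<^sup>* w\<parallel>\<close>,
  and the best \<open>w\<close> makes the last factor at most \<open>\<delta> \<parallel>e\<parallel>\<close>, which gives the first estimate. The second
  follows from it by Pythagoras: \<open>\<parallel>u - u\<^sub>r\<parallel>\<^sup>2 = \<parallel>u - u\<^sub>r\<^sup>*\<parallel>\<^sup>2 + \<parallel>e\<parallel>\<^sup>2 \<le> \<parallel>u - u\<^sub>r\<^sup>*\<parallel>\<^sup>2 + \<delta>\<^sup>2 \<parallel>u - u\<^sub>r\<parallel>\<^sup>2\<close>.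

  What remains is that the minimum and the maximum in \<open>\<delta>\<close> exist, as otherwise \<open>LEAST\<close> and
  \<open>GREATEST\<close> would be unspecified values. The \<open>X\<close>-norm dominates a multiple of the Euclidean
  norm, so its sublevel sets are compact and the distance to the subspace \<open>B\<^sup>* X\<^sub>r\<close> is attained
  (\<open>X_distance_to_subspace_attained\<close>). The ratio is invariant under scaling of \<open>v\<close> and
  continuous, because a distance function is 1-Lipschitz, so its maximum over \<open>X\<^sub>r - {0}\<close> is
  attained on the compact unit sphere of \<open>X\<^sub>r\<close> (\<open>delta_bounds_min_ratio\<close>). For
  \<open>X\<^sub>r = {0}\<close>, where \<open>\<delta> = 0\<close> by convention, \<open>e = 0\<close> and both estimates are trivial.
\<close>

section \<open>The inner product of a symmetric positive definite matrix\<close>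

definition inner_X :: "real^'n^'n \<Rightarrow> real^'n \<Rightarrow> real^'n \<Rightarrow> real" where
  "inner_X R x y = (R *v x) \<bullet> y"

lemma inner_transpose: "x \<bullet> (transpose B *v y) = (B *v x) \<bullet> y" for B :: "real^'n^'n"
  by (metis dot_lmul_matrix inner_commute transpose_matrix_vector)

context
  fixes R :: "real^'n^'n"
  assumes R: "spd_matrix R"
begin

lemma inner_X_commute: "inner_X R x y = inner_X R y x"
  using R inner_transpose[of x R y] by (simp add: inner_X_def spd_matrix_def inner_commute)

lemma inner_X_linear:
  "inner_X R (x + y) z = inner_X R x z + inner_X R y z"
  "inner_X R (x - y) z = inner_X R x z - inner_X R y z"
  "inner_X R (a *\<^sub>R x) z = a * inner_X R x z"
  "inner_X R x (y + z) = inner_X R x y + inner_X R x z"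
  "inner_X R x (y - z) = inner_X R x y - inner_X R x z"
  "inner_X R x (a *\<^sub>R z) = a * inner_X R x z"
  by (simp_all add: inner_X_def algebra_simps)

lemma inner_X_pos: "v \<noteq> 0 \<Longrightarrow> inner_X R v v > 0"
  using R by (simp add: inner_X_def spd_matrix_def)

lemma inner_X_nonneg: "inner_X R v v \<ge> 0"
  using inner_X_pos[of v] by (cases "v = 0") (auto simp: inner_X_def)

lemma norm_X_square: "(norm_X R v)\<^sup>2 = inner_X R v v"
  using inner_X_nonneg[of v] by (simp add: norm_X_def inner_X_def)

lemma norm_X_nonneg: "norm_X R v \<ge> 0"
  using inner_X_nonneg[of v] by (simp add: norm_X_def inner_X_def)

lemma norm_X_pos: "v \<noteq> 0 \<Longrightarrow> norm_X R v > 0"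
  using inner_X_pos[of v] by (simp add: norm_X_def inner_X_def)

lemma norm_X_zero: "norm_X R 0 = 0"
  by (simp add: norm_X_def)

lemma norm_X_scaleR: "norm_X R (a *\<^sub>R v) = \<bar>a\<bar> * norm_X R v"
  by (simp add: norm_X_def matrix_vector_mult_scaleR real_sqrt_mult flip: mult.assoc)

lemma norm_X_minus_commute: "norm_X R (x - y) = norm_X R (y - x)"
  using norm_X_scaleR[of "-1" "x - y"] by simp

lemma inner_X_Cauchy_Schwarz: "inner_X R x y \<le> norm_X R x * norm_X R y"
proof (cases "y = 0")
  case True
  then show ?thesis by (simp add: inner_X_def norm_X_zero)
next
  case False
  define c where "c = inner_X R y y"
  have c: "c > 0" using inner_X_pos[OF False] by (simp add: c_def)
  let ?t = "inner_X R x y / c"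
  have "0 \<le> inner_X R (x - ?t *\<^sub>R y) (x - ?t *\<^sub>R y)"
    by (rule inner_X_nonneg)
  also have "\<dots> = inner_X R x x - (inner_X R x y)\<^sup>2 / c"
    using c by (simp add: inner_X_linear inner_X_commute[of y x] power2_eq_square field_simps
        flip: c_def)
  finally have "(inner_X R x y)\<^sup>2 \<le> inner_X R x x * c"
    using c by (simp add: field_simps)
  also have "\<dots> = (norm_X R x * norm_X R y)\<^sup>2"
    by (simp add: power_mult_distrib norm_X_square c_def)
  finally show ?thesis
    by (rule power2_le_imp_le) (simp add: norm_X_nonneg)
qed

lemma norm_X_triangle: "norm_X R (x + y) \<le> norm_X R x + norm_X R y"
proof (rule power2_le_imp_le)
  show "(norm_X R (x + y))\<^sup>2 \<le> (norm_X R x + norm_X R y)\<^sup>2"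
    using inner_X_Cauchy_Schwarz[of x y]
    by (simp add: norm_X_square inner_X_linear inner_X_commute[of y x] power2_sum)
qed (simp add: norm_X_nonneg)

lemma norm_X_Pythagoras:
  assumes "inner_X R x y = 0"
  shows "(norm_X R (x + y))\<^sup>2 = (norm_X R x)\<^sup>2 + (norm_X R y)\<^sup>2"
  using assms by (simp add: norm_X_square inner_X_linear inner_X_commute[of y x])

lemma continuous_on_norm_X:
  assumes "continuous_on S f"
  shows "continuous_on S (\<lambda>x. norm_X R (f x))"
proof -
  have "continuous_on S (\<lambda>x. R *v f x)"
    using assms by (rule bounded_linear.continuous_on[OF matrix_vector_mul_bounded_linear])
  then show ?thesis
    unfolding norm_X_def using assms by (intro continuous_intros)
qed

lemma spd_matrix_inverse: "R *v (matrix_inv R *v x) = x"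
proof -
  have "R *v v = 0 \<Longrightarrow> v = 0" for v
    using inner_X_pos[of v] by (auto simp: inner_X_def)
  then have "invertible R"
    using invertible_left_inverse matrix_left_invertible_ker by blast
  then obtain R' where "R ** R' = mat 1 \<and> R' ** R = mat 1"
    unfolding invertible_def by blast
  then have "R ** matrix_inv R = mat 1 \<and> matrix_inv R ** R = mat 1"
    unfolding matrix_inv_def by (rule someI)
  then show ?thesis
    by (simp add: matrix_vector_mul_assoc)
qed

text \<open>
  By homogeneity it suffices to minimise the \<open>X\<close>-norm over the compact Euclidean unit sphere. This
  half of the equivalence of norms makes closed \<open>X\<close>-bounded sets compact.
\<close>
lemma norm_X_coercive: "\<exists>c>0. \<forall>v. c * norm v \<le> norm_X R v"
proof -
  have "\<exists>z\<in>sphere 0 1. \<forall>y\<in>sphere (0::real^'n) 1. norm_X R z \<le> norm_X R y"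
    by (rule continuous_attains_inf) (auto intro!: continuous_on_norm_X)
  then obtain z :: "real^'n" where z: "norm z = 1"
    and min: "\<And>y. norm y = 1 \<Longrightarrow> norm_X R z \<le> norm_X R y"
    by auto
  have "norm_X R z * norm v \<le> norm_X R v" for v
  proof (cases "v = 0")
    case False
    then have "norm_X R z \<le> norm_X R v / norm v"
      using min[of "v /\<^sub>R norm v"] by (simp add: norm_X_scaleR divide_inverse mult.commute)
    with False show ?thesis by (simp add: field_simps)
  qed (simp add: norm_X_zero)
  moreover have "norm_X R z > 0"
    using z by (intro norm_X_pos) auto
  ultimately show ?thesis by blast
qed

text \<open>
  As \<open>0 \<in> S\<close>, only the points of \<open>S\<close> with \<open>\<parallel>v - s\<parallel> \<le> \<parallel>v\<parallel>\<close> compete, and by coercivity they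
  form a compact set.
\<close>
lemma X_distance_to_subspace_attained:
  assumes "subspace S"
  shows "\<exists>p\<in>S. \<forall>s\<in>S. norm_X R (v - p) \<le> norm_X R (v - s)"
proof -
  obtain c where c: "c > 0" "\<And>x. c * norm x \<le> norm_X R x"
    using norm_X_coercive by blast
  define K where "K = S \<inter> cball v (norm_X R v / c)"
  have K: "s \<in> K" if "s \<in> S" "norm_X R (v - s) \<le> norm_X R v" for s
  proof -
    have "c * norm (v - s) \<le> norm_X R v" using c(2) that(2) order_trans by blast
    then show ?thesis using that(1) c(1) by (simp add: K_def dist_norm field_simps)
  qed
  have 0: "0 \<in> K" using K[of 0] assms by (simp add: subspace_0)
  have "compact K"
    unfolding K_def using assms by (intro closed_Int_compact closed_subspace compact_cball)
  then obtain p where p: "p \<in> K" "\<And>s. s \<in> K \<Longrightarrow> norm_X R (v - p) \<le> norm_X R (v - s)"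
    using 0 continuous_attains_inf[of K "\<lambda>s. norm_X R (v - s)"]
      continuous_on_norm_X[OF continuous_on_diff[OF continuous_on_const continuous_on_id]]
    by blast
  have "norm_X R (v - p) \<le> norm_X R (v - s)" if "s \<in> S" for s
  proof (cases "norm_X R (v - s) \<le> norm_X R v")
    case True
    then show ?thesis using K p(2) that by blast
  next
    case False
    then show ?thesis using p(2)[OF 0] by simp
  qed
  then show ?thesis using p(1) by (auto simp: K_def)
qed

section \<open>Existence of the minimum and of the maximum\<close>

text \<open>
  The points \<open>R\<^sup>-\<^sup>1 B\<^sup>T R w\<close> with \<open>w \<in> X\<^sub>r\<close> form a subspace, although \<open>w\<close> need not be determined by
  its image; the minimiser is therefore sought among the images.
\<close>
lemma min_ratio_attained:
  assumes "subspace Xr"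
  shows "\<exists>w\<in>Xr. min_ratio R Xr B v
      = norm_X R (v - matrix_inv R *v (transpose B *v (R *v w))) / norm_X R v" (is ?attained)
    and "w \<in> Xr \<Longrightarrow> min_ratio R Xr B v
      \<le> norm_X R (v - matrix_inv R *v (transpose B *v (R *v w))) / norm_X R v"
proof -
  define M where "M = (\<lambda>w. matrix_inv R *v (transpose B *v (R *v w)))"
  have M: "matrix_inv R *v (transpose B *v (R *v w)) = M w" for w
    by (simp only: M_def)
  have "linear M"
    unfolding M_def by (simp add: matrix_vector_mul_assoc)
  then have "subspace (M ` Xr)"
    using assms by (rule linear_subspace_image)
  from X_distance_to_subspace_attained[OF this]
  obtain w0 where w0: "w0 \<in> Xr" "\<And>w. w \<in> Xr \<Longrightarrow> norm_X R (v - M w0) \<le> norm_X R (v - M w)"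
    by fastforce
  have le: "norm_X R (v - M w0) / norm_X R v \<le> norm_X R (v - M w) / norm_X R v"
    if "w \<in> Xr" for w
    using w0(2)[OF that] by (intro divide_right_mono norm_X_nonneg)
  have eq: "min_ratio R Xr B v = norm_X R (v - M w0) / norm_X R v"
    unfolding min_ratio_def M
    by (rule Least_equality) (use w0(1) le in auto)
  show ?attained using eq w0(1) unfolding M by blast
  show "w \<in> Xr \<Longrightarrow> min_ratio R Xr B v
      \<le> norm_X R (v - matrix_inv R *v (transpose B *v (R *v w))) / norm_X R v"
    using eq le unfolding M by simp
qed

lemma min_ratio_nonneg: "subspace Xr \<Longrightarrow> 0 \<le> min_ratio R Xr B v"
  using min_ratio_attained(1)[of Xr B v] norm_X_nonneg by fastforce

text \<open>The choice \<open>w = 0\<close> gives the ratio 1.\<close>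
lemma min_ratio_le_1:
  assumes "subspace Xr" and "v \<noteq> 0"
  shows "min_ratio R Xr B v \<le> 1"
  using min_ratio_attained(2)[OF assms(1), of 0 B v] norm_X_pos[OF assms(2)] subspace_0[OF assms(1)]
  by simp

lemma min_ratio_scaleR:
  assumes Xr: "subspace Xr" and "a \<noteq> 0"
  shows "min_ratio R Xr B (a *\<^sub>R v) = min_ratio R Xr B v"
proof -
  have le: "min_ratio R Xr B (a *\<^sub>R v) \<le> min_ratio R Xr B v" if a: "a \<noteq> 0" for a v
  proof -
    obtain w where w: "w \<in> Xr" "min_ratio R Xr B v
        = norm_X R (v - matrix_inv R *v (transpose B *v (R *v w))) / norm_X R v"
      using min_ratio_attained(1)[OF Xr] by blast
    have "min_ratio R Xr B (a *\<^sub>R v) \<le> norm_X R (a *\<^sub>R v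
        - matrix_inv R *v (transpose B *v (R *v (a *\<^sub>R w)))) / norm_X R (a *\<^sub>R v)"
      using w(1) Xr by (intro min_ratio_attained(2)) (auto simp: subspace_scale)
    also have "\<dots> = min_ratio R Xr B v"
      using a norm_X_scaleR[of a "v - matrix_inv R *v (transpose B *v (R *v w))"]
      by (simp add: w(2) norm_X_scaleR matrix_vector_mult_scaleR scaleR_diff_right)
    finally show ?thesis .
  qed
  show ?thesis
    using le[of a v] le[of "inverse a" "a *\<^sub>R v"] assms(2) by simp
qed

text \<open>
  The numerator of the ratio is a distance to a fixed set, hence 1-Lipschitz for the \<open>X\<close>-norm by the
  triangle inequality.
\<close>
lemma continuous_on_min_ratio:
  assumes Xr: "subspace Xr"
  shows "continuous_on (- {0}) (min_ratio R Xr B)"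
proof -
  define D where "D = (\<lambda>v. min_ratio R Xr B v * norm_X R v)"
  have lip: "D v - D v' \<le> norm_X R (v - v')" if v: "v \<noteq> 0" "v' \<noteq> 0" for v v'
  proof -
    obtain w where w: "w \<in> Xr" "min_ratio R Xr B v'
        = norm_X R (v' - matrix_inv R *v (transpose B *v (R *v w))) / norm_X R v'"
      using min_ratio_attained(1)[OF Xr] by blast
    let ?p = "matrix_inv R *v (transpose B *v (R *v w))"
    have "D v \<le> norm_X R (v - ?p)"
      using min_ratio_attained(2)[OF Xr w(1), of B v] norm_X_pos[OF v(1)]
      by (simp add: D_def field_simps)
    also have "\<dots> \<le> norm_X R (v - v') + norm_X R (v' - ?p)"
      using norm_X_triangle[of "v - v'" "v' - ?p"] by simp
    also have "norm_X R (v' - ?p) = D v'"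
      using w(2) norm_X_pos[OF v(2)] by (simp add: D_def)
    finally show ?thesis by simp
  qed
  have "continuous_on (- {0}) D"
    unfolding continuous_on_def
  proof (rule ballI, rule LIM_zero_cancel, rule Lim_null_comparison)
    fix v :: "real^'n" assume v: "v \<in> - {0}"
    have "norm (D x - D v) \<le> norm_X R (x - v)" if "x \<noteq> 0" for x
      using lip[of x v] lip[of v x] v that norm_X_minus_commute[of v x] by simp
    then show "\<forall>\<^sub>F x in at v within - {0}. norm (D x - D v) \<le> norm_X R (x - v)"
      by (simp add: eventually_at_filter)
    have "continuous_on (- {0}) (\<lambda>x. norm_X R (x - v))"
      by (intro continuous_on_norm_X continuous_intros)
    then show "((\<lambda>x. norm_X R (x - v)) \<longlongrightarrow> 0) (at v within - {0})"
      using v unfolding continuous_on_def by (metis diff_self norm_X_zero)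
  qed
  then have "continuous_on (- {0}) (\<lambda>v. D v / norm_X R v)"
  proof (rule continuous_on_divide)
    show "\<forall>v\<in>- {0}. norm_X R v \<noteq> 0"
      by (metis ComplD less_irrefl norm_X_pos singletonI)
  qed (intro continuous_on_norm_X continuous_on_id)
  moreover have "D v / norm_X R v = min_ratio R Xr B v" if "v \<in> - {0}" for v
    using that norm_X_pos[of v] by (simp add: D_def)
  ultimately show ?thesis
    by (rule continuous_on_eq)
qed

text \<open>
  By scaling invariance the maximum over the nonzero vectors of \<open>X\<^sub>r\<close> is a maximum over the compact
  unit sphere of \<open>X\<^sub>r\<close>, where it is attained by continuity.
\<close>
lemma delta_bounds_min_ratio:
  assumes Xr: "subspace Xr"
  shows delta_mem_unit_interval: "delta R Xr B \<in> {0..1}"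
    and "v \<in> Xr \<Longrightarrow> v \<noteq> 0 \<Longrightarrow> min_ratio R Xr B v \<le> delta R Xr B"
proof -
  have "delta R Xr B \<in> {0..1} \<and> (\<forall>v\<in>Xr. v \<noteq> 0 \<longrightarrow> min_ratio R Xr B v \<le> delta R Xr B)"
  proof (cases "Xr \<subseteq> {0}")
    case True
    then show ?thesis by (auto simp: delta_def)
  next
    case False
    define K where "K = Xr \<inter> sphere 0 1"
    have normalise: "v /\<^sub>R norm v \<in> K" if "v \<in> Xr" "v \<noteq> 0" for v
      using that Xr by (auto simp: K_def subspace_scale)
    then have "K \<noteq> {}" using False by blast
    moreover have "compact K"
      unfolding K_def using Xr by (intro closed_Int_compact closed_subspace compact_sphere)
    moreover have "continuous_on K (min_ratio R Xr B)"
      by (rule continuous_on_subset[OF continuous_on_min_ratio[OF Xr]]) (auto simp: K_def)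
    ultimately have "\<exists>z\<in>K. \<forall>v\<in>K. min_ratio R Xr B v \<le> min_ratio R Xr B z"
      by (intro continuous_attains_sup)
    then obtain z where z: "z \<in> K" "\<And>v. v \<in> K \<Longrightarrow> min_ratio R Xr B v \<le> min_ratio R Xr B z"
      by blast
    have max: "min_ratio R Xr B v \<le> min_ratio R Xr B z" if "v \<in> Xr" "v \<noteq> 0" for v
      using z(2)[OF normalise[OF that]] min_ratio_scaleR[OF Xr, of "inverse (norm v)" B v] that(2)
      by simp
    have z': "z \<in> Xr" "z \<noteq> 0" using z(1) by (auto simp: K_def)
    have "delta R Xr B = (GREATEST d. \<exists>v\<in>Xr. v \<noteq> 0 \<and> d = min_ratio R Xr B v)"
      using False by (simp add: delta_def)
    also have "\<dots> = min_ratio R Xr B z"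
      by (rule Greatest_equality) (use z' max in auto)
    finally show ?thesis
      using max min_ratio_nonneg[OF Xr] min_ratio_le_1[OF Xr z'(2)] by auto
  qed
  then show "delta R Xr B \<in> {0..1}"
    and "v \<in> Xr \<Longrightarrow> v \<noteq> 0 \<Longrightarrow> min_ratio R Xr B v \<le> delta R Xr B"
    by auto
qed

section \<open>The Petrov-Galerkin error\<close>

text \<open>
  The vector \<open>x\<close> stands for the error of the Petrov-Galerkin solution, which is \<open>X\<close>-orthogonal to the
  images \<open>R\<^sup>-\<^sup>1 B\<^sup>T R w\<close>, and \<open>e\<close> for its \<open>X\<close>-orthogonal projection on \<open>X\<^sub>r\<close>. Subtracting from \<open>e\<close> the
  best such image does not change \<open>\<langle>x, e\<rangle>\<^sub>X = \<parallel>e\<parallel>\<^sup>2\<close>, and Cauchy-Schwarz concludes.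
\<close>
lemma norm_X_projection_le_delta:
  assumes Xr: "subspace Xr" and e: "e \<in> Xr" and proj: "inner_X R x e = inner_X R e e"
    and orth: "\<And>w. w \<in> Xr \<Longrightarrow> x \<bullet> (transpose B *v (R *v w)) = 0"
  shows "norm_X R e \<le> delta R Xr B * norm_X R x"
proof (cases "e = 0")
  case True
  then show ?thesis
    using delta_mem_unit_interval[OF Xr, of B] norm_X_nonneg[of x] by (simp add: norm_X_zero)
next
  case False
  have pos: "norm_X R e > 0" by (rule norm_X_pos[OF False])
  obtain w where w: "w \<in> Xr" "min_ratio R Xr B e
      = norm_X R (e - matrix_inv R *v (transpose B *v (R *v w))) / norm_X R e"
    using min_ratio_attained(1)[OF Xr] by blast
  let ?p = "matrix_inv R *v (transpose B *v (R *v w))"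
  have "inner_X R x ?p = inner_X R ?p x" by (rule inner_X_commute)
  also have "\<dots> = 0"
    using orth[OF w(1)] by (simp add: inner_X_def spd_matrix_inverse inner_commute)
  finally have "(norm_X R e)\<^sup>2 = inner_X R x (e - ?p)"
    using proj by (simp add: inner_X_linear norm_X_square)
  also have "\<dots> \<le> norm_X R x * norm_X R (e - ?p)"
    by (rule inner_X_Cauchy_Schwarz)
  also have "\<dots> = norm_X R x * (min_ratio R Xr B e * norm_X R e)"
    using pos by (simp add: w(2))
  also have "\<dots> \<le> norm_X R x * (delta R Xr B * norm_X R e)"
    using delta_bounds_min_ratio(2)[OF Xr e False, of B] norm_X_nonneg
    by (intro mult_left_mono mult_right_mono)
  finally have "norm_X R e * norm_X R e \<le> (delta R Xr B * norm_X R x) * norm_X R e"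
    by (simp add: power2_eq_square mult_ac)
  then show ?thesis using pos by (simp only: mult_le_cancel_right_pos)
qed

end

theorem proposition3p2:
  fixes \<Xi> :: "'p set" and \<xi> :: 'p
    and A :: "'p \<Rightarrow> real^'n^'n" and b u :: "'p \<Rightarrow> real^'n"
    and R :: "real^'n^'n"
    and Xr :: "(real^'n) set" and r m :: nat
    and lam :: "nat \<Rightarrow> 'p \<Rightarrow> real" and pts :: "nat \<Rightarrow> 'p"
    and P :: "'p \<Rightarrow> real^'n^'n"
    and \<delta> :: "'p \<Rightarrow> real"
    and ur_star ur :: "'p \<Rightarrow> real^'n"
  assumes A_inv: "\<forall>\<eta>\<in>\<Xi>. invertible (A \<eta>)"
    and u_sol: "\<forall>\<eta>\<in>\<Xi>. A \<eta> *v u \<eta> = b \<eta>"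
    and R_spd: "spd_matrix R"
    and Xr_sub: "subspace Xr" and Xr_dim: "dim Xr = r"
    and pts_in: "\<forall>i\<in>{1..m}. pts i \<in> \<Xi>"
    and P_eq: "\<forall>\<eta>\<in>\<Xi>. P \<eta> = preconditioner A m lam pts \<eta>"
    and \<xi>_in: "\<xi> \<in> \<Xi>"
    and \<delta>_eq: "\<delta> \<xi> = delta R Xr (P \<xi> ** A \<xi>)"
    and ur_star_in: "ur_star \<xi> \<in> Xr"
    and ur_star_sol: "\<forall>v\<in>Xr. (ur_star \<xi> - u \<xi>) \<bullet> (R *v v) = 0"
    and ur_in: "ur \<xi> \<in> Xr"
    and ur_sol: "\<forall>v\<in>Xr. (A \<xi> *v ur \<xi> - b \<xi>) \<bullet> (transpose (P \<xi>) *v (R *v v)) = 0"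
  shows "\<delta> \<xi> \<in> {0..1} \<and>
    norm_X R (ur_star \<xi> - ur \<xi>) \<le> \<delta> \<xi> * norm_X R (u \<xi> - ur \<xi>) \<and>
    (\<delta> \<xi> < 1 \<longrightarrow>
      norm_X R (u \<xi> - ur \<xi>) \<le> (1 - (\<delta> \<xi>)\<^sup>2) powr (- 1 / 2) * norm_X R (u \<xi> - ur_star \<xi>))"
proof -
  define B where "B = P \<xi> ** A \<xi>"
  define x where "x = u \<xi> - ur \<xi>"
  define e where "e = ur_star \<xi> - ur \<xi>"
  define d where "d = \<delta> \<xi>"
  have e: "e \<in> Xr"
    unfolding e_def using Xr_sub ur_star_in ur_in by (rule subspace_diff)
  have x: "x = (u \<xi> - ur_star \<xi>) + e" by (simp add: x_def e_def)
  have galerkin: "inner_X R (u \<xi> - ur_star \<xi>) e = 0"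
    using ur_star_sol e inner_X_commute[OF R_spd, of "u \<xi> - ur_star \<xi>" e]
    by (simp add: inner_X_def inner_commute inner_diff_right)
  have orth: "x \<bullet> (transpose B *v (R *v w)) = 0" if "w \<in> Xr" for w
  proof -
    have "x \<bullet> (transpose B *v (R *v w)) = (B *v x) \<bullet> (R *v w)"
      by (rule inner_transpose)
    also have "\<dots> = (A \<xi> *v x) \<bullet> (transpose (P \<xi>) *v (R *v w))"
      by (simp only: B_def inner_transpose flip: matrix_vector_mul_assoc)
    also have "A \<xi> *v x = - (A \<xi> *v ur \<xi> - b \<xi>)"
      using u_sol \<xi>_in by (simp add: x_def matrix_vector_mult_diff_distrib)
    finally show ?thesis using ur_sol that by (simp del: minus_diff_eq)
  qed
  have d: "d \<in> {0..1}"
    unfolding d_def \<delta>_eq by (rule delta_mem_unit_interval[OF R_spd Xr_sub])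
  have first: "norm_X R e \<le> d * norm_X R x"
    unfolding d_def \<delta>_eq B_def[symmetric]
    using e galerkin orth
    by (intro norm_X_projection_le_delta[OF R_spd Xr_sub]) (auto simp: x inner_X_linear[OF R_spd])
  have second: "norm_X R x \<le> (1 - d\<^sup>2) powr (- 1 / 2) * norm_X R (u \<xi> - ur_star \<xi>)"
    if "d < 1"
  proof -
    have pos: "1 - d\<^sup>2 > 0"
      using that d power_strict_mono[of d 1 2] by simp
    have "(norm_X R x)\<^sup>2 = (norm_X R (u \<xi> - ur_star \<xi>))\<^sup>2 + (norm_X R e)\<^sup>2"
      unfolding x by (rule norm_X_Pythagoras[OF R_spd galerkin])
    also have "(norm_X R e)\<^sup>2 \<le> (d * norm_X R x)\<^sup>2"
      using first norm_X_nonneg[OF R_spd] by (intro power_mono)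
    finally have "(1 - d\<^sup>2) * (norm_X R x)\<^sup>2 \<le> (norm_X R (u \<xi> - ur_star \<xi>))\<^sup>2"
      by (simp add: algebra_simps)
    then have "sqrt ((1 - d\<^sup>2) * (norm_X R x)\<^sup>2) \<le> sqrt ((norm_X R (u \<xi> - ur_star \<xi>))\<^sup>2)"
      by (rule real_sqrt_le_mono)
    then have "sqrt (1 - d\<^sup>2) * norm_X R x \<le> norm_X R (u \<xi> - ur_star \<xi>)"
      using norm_X_nonneg[OF R_spd] by (simp add: real_sqrt_mult)
    moreover have "(1 - d\<^sup>2) powr (- 1 / 2) = 1 / sqrt (1 - d\<^sup>2)"
      using pos by (simp add: powr_minus_divide powr_half_sqrt)
    moreover have "sqrt (1 - d\<^sup>2) > 0" using pos by simp
    ultimately show ?thesis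
      by (simp only: pos_le_divide_eq times_divide_eq_right mult_1_right mult.commute)
  qed
  show ?thesis
    using d first second unfolding d_def x_def e_def by blast
qed

end
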